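(* Let $0\ne v=\sum_{i=1}^{n}a_ie_i\in\mathbb{Z}^n$ with $\gcd(a_1,\ldots,a_n)=1$, and let $R_v=I-2\frac{vv^{T}}{v^{T}v}$ be the matrix of the reflection defined by $v$. Then $$\Sigma(R_v)=\begin{cases} v^{T}v & \text{if } v^{T}v \text{ is odd},\\ v^{T}v/2 & \text{if } v^{T}v \text{ is even}.\end{cases}$$
   Context: $(e_1,\ldots,e_n)$ is the canonical basis of $\mathbb{R}^n$, vectors are regarded as columns, and $v^T$ is the transpose of $v$. For a rational orthogonal $n\times n$ matrix $Y$, the coincidence index is the (finite) group index $\Sigma(Y)=[\mathbb{Z}^n:\mathbb{Z}^n\cap Y\mathbb{Z}^n]$. *)

theory Defs
  imports "HOL-Analysis.Analysis" "HOL-Algebra.Coset"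
begin

definition int_lattice :: "(real ^ 'n) set" where
  "int_lattice = {x. \<forall>i. x $ i \<in> \<int>}"

definition int_lattice_group :: "(real ^ 'n) monoid" where
  "int_lattice_group = \<lparr>carrier = int_lattice, mult = (+), one = 0\<rparr>"

definition coincidence_lattice :: "real ^ 'n ^ 'n \<Rightarrow> (real ^ 'n) set" where
  "coincidence_lattice Y = int_lattice \<inter> (*v) Y ` int_lattice"

text \<open>
  The coincidence index is the number of cosets. As \<open>card\<close> is 0 on infinite sets, a
  positive value includes the claim that the index is finite.
\<close>

definition coincidence_index :: "real ^ 'n ^ 'n \<Rightarrow> nat" where
  "coincidence_index Y = card (rcosets\<^bsub>int_lattice_group\<^esub> (coincidence_lattice Y))"

text \<open>
  The auxiliary column and row matrices have inner dimension 1, so that their product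
  is \<open>v v\<^sup>T\<close>; the scalar \<open>v\<^sup>T v\<close> is \<open>v \<bullet> v\<close>.
\<close>

definition reflection_matrix :: "real ^ 'n \<Rightarrow> real ^ 'n ^ 'n" where
  "reflection_matrix v =
     mat 1 - (2 / (v \<bullet> v)) *\<^sub>R ((columnvector v :: real ^ 1 ^ 'n) ** (rowvector v :: real ^ 'n ^ 1))"

lemma comm_group_int_lattice_group: "comm_group (int_lattice_group :: (real ^ 'n) monoid)"
proof (rule comm_groupI)
  fix x :: "real ^ 'n"
  assume "x \<in> carrier int_lattice_group"
  then show "\<exists>y\<in>carrier int_lattice_group. y \<otimes>\<^bsub>int_lattice_group\<^esub> x = \<one>\<^bsub>int_lattice_group\<^esub>"
    by (intro bexI[of _ "- x"]) (auto simp: int_lattice_group_def int_lattice_def)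
qed (auto simp: int_lattice_group_def int_lattice_def add_ac)

lemma subgroup_coincidence_lattice:
  fixes Y :: "real ^ 'n ^ 'n"
  shows "subgroup (coincidence_lattice Y) int_lattice_group"
proof -
  interpret comm_group "int_lattice_group :: (real ^ 'n) monoid"
    by (rule comm_group_int_lattice_group)
  have inv: "inv\<^bsub>int_lattice_group\<^esub> x = - x" if "x \<in> int_lattice" for x :: "real ^ 'n"
    by (rule inv_equality) (use that in \<open>auto simp: int_lattice_group_def int_lattice_def\<close>)
  show ?thesis
  proof (rule subgroupI)
    show "coincidence_lattice Y \<subseteq> carrier int_lattice_group"
      by (auto simp: coincidence_lattice_def int_lattice_group_def)
    have "0 \<in> coincidence_lattice Y"
      unfolding coincidence_lattice_def int_lattice_def
      by (auto intro!: image_eqI[of _ _ 0])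
    then show "coincidence_lattice Y \<noteq> {}" by auto
  next
    fix x assume "x \<in> coincidence_lattice Y"
    then obtain y where y: "x \<in> int_lattice" "y \<in> int_lattice" "x = Y *v y"
      by (auto simp: coincidence_lattice_def)
    have "- x = Y *v (- y)"
      using y(3) matrix_vector_mult_diff_distrib[of Y 0 y] by simp
    moreover have "- x \<in> int_lattice" "- y \<in> int_lattice"
      using y(1,2) by (simp_all add: int_lattice_def)
    ultimately have "- x \<in> coincidence_lattice Y"
      unfolding coincidence_lattice_def by blast
    with inv[OF y(1)] show "inv\<^bsub>int_lattice_group\<^esub> x \<in> coincidence_lattice Y" by simp
  next
    fix x x' assume "x \<in> coincidence_lattice Y" "x' \<in> coincidence_lattice Y"
    then obtain y y' where y: "x \<in> int_lattice" "y \<in> int_lattice" "x = Y *v y"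
      "x' \<in> int_lattice" "y' \<in> int_lattice" "x' = Y *v y'"
      by (auto simp: coincidence_lattice_def)
    have "x + x' = Y *v (y + y')"
      using y by (simp add: matrix_vector_right_distrib)
    moreover have "x + x' \<in> int_lattice" "y + y' \<in> int_lattice"
      using y(1,2,4,5) by (simp_all add: int_lattice_def)
    ultimately have "x + x' \<in> coincidence_lattice Y"
      unfolding coincidence_lattice_def by blast
    then show "x \<otimes>\<^bsub>int_lattice_group\<^esub> x' \<in> coincidence_lattice Y"
      by (simp add: int_lattice_group_def)
  qed
qed

end

theory Submission
  imports Defs "HOL-Algebra.Elementary_Groups"
begin

text \<open>
  Write \<open>N = v \<bullet> v\<close>. The reflection sends \<open>x\<close> to \<open>x - t v\<close> with \<open>t = 2 (v \<bullet> x) / N\<close>. It is an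
  involution, so an integer vector lies in the coincidence lattice iff its image is again an
  integer vector, that is, iff \<open>t v\<close> is integral. As the coordinates of \<open>v\<close> are coprime, Bezout
  turns this into \<open>t \<in> \<int>\<close>, i.e. \<open>N dvd 2 (v \<bullet> x)\<close>, i.e. \<open>M dvd v \<bullet> x\<close>, where \<open>M\<close> is \<open>N\<close> or \<open>N / 2\<close>
  according to the parity of \<open>N\<close>. Hence the coincidence lattice is the kernel of the homomorphism
  \<open>x \<mapsto> (v \<bullet> x) mod M\<close> from the integer lattice to the integers modulo \<open>M\<close>. By Bezout again this
  homomorphism is onto, so the index of its kernel is \<open>M\<close>.
\<close>

text \<open>
  Folding the two-term Bezout identity over the index set: the old coefficients are scaled by the
  coefficient of the previous gcd. For coprime coordinates this yields an integer vector \<open>u\<close> with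
  \<open>v \<bullet> u = 1\<close>.
\<close>

lemma bezout_Gcd_image_int:
  fixes a :: "'i \<Rightarrow> int"
  assumes "finite A"
  shows "\<exists>b. (\<Sum>i\<in>A. a i * b i) = Gcd (a ` A)"
  using assms
proof (induction A rule: finite_induct)
  case empty
  show ?case by simp
next
  case (insert j A)
  then obtain b where b: "(\<Sum>i\<in>A. a i * b i) = Gcd (a ` A)" by blast
  obtain p q where pq: "p * a j + q * Gcd (a ` A) = gcd (a j) (Gcd (a ` A))"
    using bezout_int by blast
  let ?c = "\<lambda>i. if i = j then p else q * b i"
  have "(\<Sum>i\<in>A. a i * ?c i) = (\<Sum>i\<in>A. q * (a i * b i))"
    using insert.hyps by (intro sum.cong) auto
  also have "\<dots> = q * Gcd (a ` A)" by (simp add: b flip: sum_distrib_left)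
  finally have "(\<Sum>i\<in>insert j A. a i * ?c i) = Gcd (a ` insert j A)"
    using insert.hyps pq by (simp add: mult.commute)
  then show ?case by (intro exI[of _ ?c])
qed

text \<open>The first isomorphism theorem, read as a count of cosets.\<close>

lemma card_rcosets_kernel:
  assumes "group G" "group H" "h \<in> hom G H" "h ` carrier G = carrier H"
  shows "card (rcosets\<^bsub>G\<^esub> (kernel G H h)) = card (carrier H)"
proof -
  interpret group_hom G H h
    using assms(1-3) by (intro group_hom.intro group_hom_axioms.intro)
  have "bij_betw (\<lambda>X. the_elem (h ` X)) (carrier (G Mod kernel G H h)) (carrier H)"
    using FactGroup_iso_set[OF assms(4)] by (simp add: iso_def)
  then show ?thesis
    by (auto simp: FactGroup_def dest: bij_betw_same_card)
qed

lemma columnvector_mult_rowvector_mult_vec: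
  fixes v x :: "real ^ 'n"
  shows "((columnvector v :: real ^ 1 ^ 'n) ** (rowvector v :: real ^ 'n ^ 1)) *v x = (v \<bullet> x) *\<^sub>R v"
  by (simp add: vec_eq_iff matrix_vector_mult_def matrix_matrix_mult_def columnvector_def
      rowvector_def inner_vec_def sum_distrib_left mult_ac)

lemma reflection_matrix_mult_vec:
  "reflection_matrix v *v x = x - (2 * (v \<bullet> x) / (v \<bullet> v)) *\<^sub>R v"
  unfolding reflection_matrix_def
  by (simp add: matrix_vector_mult_diff_rdistrib columnvector_mult_rowvector_mult_vec
      flip: scaleR_matrix_vector_assoc)

lemma reflection_matrix_involution:
  assumes "v \<noteq> 0"
  shows "reflection_matrix v *v (reflection_matrix v *v x) = x"
  using assms
  by (simp add: reflection_matrix_mult_vec inner_diff_right inner_scaleR_right)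

text \<open>
  An involution is its own inverse, so the only candidate for a preimage of \<open>x\<close> is \<open>Y *v x\<close>.
\<close>

lemma coincidence_lattice_involution:
  assumes "\<And>x. Y *v (Y *v x) = x"
  shows "coincidence_lattice Y = {x \<in> int_lattice. Y *v x \<in> int_lattice}"
proof -
  have "x \<in> (*v) Y ` int_lattice \<longleftrightarrow> Y *v x \<in> int_lattice" for x
    using assms by (metis (no_types, lifting) image_iff)
  then show ?thesis by (auto simp: coincidence_lattice_def)
qed

lemma Ints_div_of_int_iff:
  assumes "N \<noteq> 0"
  shows "(of_int k / of_int N :: real) \<in> \<int> \<longleftrightarrow> N dvd k"
proof
  assume "(of_int k / of_int N :: real) \<in> \<int>"
  then obtain m where "of_int k / of_int N = (of_int m :: real)" by (auto elim: Ints_cases)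
  then have "(of_int k :: real) = of_int (m * N)" using assms by (simp add: field_simps)
  then show "N dvd k" by (simp only: of_int_eq_iff dvd_triv_right)
next
  assume "N dvd k"
  then show "(of_int k / of_int N :: real) \<in> \<int>"
    using assms by (auto elim!: dvdE)
qed

lemma dvd_double_iff:
  fixes N k :: int
  shows "N dvd 2 * k \<longleftrightarrow> (if odd N then N else N div 2) dvd k"
proof (cases "odd N")
  case True
  then show ?thesis by (simp add: coprime_dvd_mult_right_iff)
next
  case False
  then obtain m where "N = 2 * m" by blast
  then show ?thesis by simp
qed

theorem theorem3p2:
  fixes a :: "'n::finite \<Rightarrow> int" and v :: "real ^ 'n"
  assumes "v = (\<Sum>i\<in>UNIV. of_int (a i) *\<^sub>R axis i 1)"
    and "v \<noteq> 0"
    and "Gcd (range a) = 1"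
  shows "\<exists>N::int. v \<bullet> v = of_int N \<and>
           real (coincidence_index (reflection_matrix v)) =
             (if odd N then v \<bullet> v else (v \<bullet> v) / 2)"
proof -
  have v_nth: "v $ i = of_int (a i)" for i
    by (simp add: assms(1) axis_def if_distrib cong: if_cong)
  define N where "N = (\<Sum>i\<in>UNIV. a i * a i)"
  define M where "M = (if odd N then N else N div 2)"
  have vv: "v \<bullet> v = of_int N"
    by (simp add: inner_vec_def v_nth N_def)
  have "N > 0"
    using assms(2) vv by (metis inner_gt_zero_iff of_int_0_less_iff)
  then have "M > 0" by (auto simp: M_def elim!: evenE)

  obtain b where b: "(\<Sum>i\<in>UNIV. a i * b i) = 1"
    using bezout_Gcd_image_int[of UNIV a] assms(3) by auto
  define u :: "real ^ 'n" where "u = (\<chi> i. of_int (b i))"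
  have u_lattice: "of_int k *\<^sub>R u \<in> int_lattice" for k
    by (simp add: int_lattice_def u_def)
  have vu: "v \<bullet> u = 1"
    using arg_cong[OF b, of real_of_int] by (simp add: inner_vec_def v_nth u_def)
  have inner_Ints: "v \<bullet> x \<in> \<int>" if "x \<in> int_lattice" for x
    using that by (auto simp: inner_vec_def v_nth int_lattice_def intro!: Ints_sum Ints_mult)

  have scaleR_lattice_iff: "t *\<^sub>R v \<in> int_lattice \<longleftrightarrow> t \<in> \<int>" for t
  proof
    assume "t *\<^sub>R v \<in> int_lattice"
    \<comment> \<open>Pairing with the Bezout vector \<open>u\<close> recovers the coefficient \<open>t\<close>.\<close>
    moreover have "t = (\<Sum>i\<in>UNIV. (t *\<^sub>R v) $ i * of_int (b i))"
      using vu by (simp add: inner_vec_def u_def mult.assoc flip: sum_distrib_left)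
    ultimately show "t \<in> \<int>"
      by (metis (mono_tags, lifting) Ints_mult Ints_of_int Ints_sum int_lattice_def mem_Collect_eq)
  next
    assume "t \<in> \<int>"
    then show "t *\<^sub>R v \<in> int_lattice"
      by (simp add: int_lattice_def v_nth)
  qed
  have image_lattice_iff: "reflection_matrix v *v x \<in> int_lattice \<longleftrightarrow> M dvd \<lfloor>v \<bullet> x\<rfloor>"
    if x: "x \<in> int_lattice" for x
  proof -
    define t where "t = 2 * (v \<bullet> x) / (v \<bullet> v)"
    have "reflection_matrix v *v x \<in> int_lattice \<longleftrightarrow> t *\<^sub>R v \<in> int_lattice"
    proof -
      have "x $ i - y \<in> \<int> \<longleftrightarrow> y \<in> \<int>" for i y
        using x Ints_diff[of "x $ i" "x $ i - y"] by (auto simp: int_lattice_def)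
      then show ?thesis
        by (simp add: reflection_matrix_mult_vec t_def int_lattice_def)
    qed
    also have "\<dots> \<longleftrightarrow> t \<in> \<int>" by (rule scaleR_lattice_iff)
    also have "t = of_int (2 * \<lfloor>v \<bullet> x\<rfloor>) / of_int N"
      using inner_Ints[OF x] by (simp add: t_def vv)
    also have "\<dots> \<in> \<int> \<longleftrightarrow> N dvd 2 * \<lfloor>v \<bullet> x\<rfloor>"
      using \<open>N > 0\<close> by (intro Ints_div_of_int_iff) simp
    also have "\<dots> \<longleftrightarrow> M dvd \<lfloor>v \<bullet> x\<rfloor>"
      by (simp only: dvd_double_iff M_def)
    finally show ?thesis .
  qed

  let ?G = "int_lattice_group :: (real ^ 'n) monoid"
  let ?H = "integer_mod_group (nat M)"
  let ?h = "\<lambda>x. \<lfloor>v \<bullet> x\<rfloor> mod M"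
  have carrier_H: "carrier ?H = {0..<M}"
    using \<open>M > 0\<close> by (simp add: carrier_integer_mod_group)
  have hom: "?h \<in> hom ?G ?H"
  proof (rule homI)
    fix x assume "x \<in> carrier ?G"
    show "?h x \<in> carrier ?H" using \<open>M > 0\<close> by (simp add: carrier_H)
  next
    fix x y assume "x \<in> carrier ?G" "y \<in> carrier ?G"
    then have "v \<bullet> x \<in> \<int>" "v \<bullet> y \<in> \<int>"
      by (simp_all add: int_lattice_group_def inner_Ints)
    then have "\<lfloor>v \<bullet> (x + y)\<rfloor> = \<lfloor>v \<bullet> x\<rfloor> + \<lfloor>v \<bullet> y\<rfloor>"
      by (auto simp: inner_add_right elim!: Ints_cases)
    then show "?h (x \<otimes>\<^bsub>?G\<^esub> y) = ?h x \<otimes>\<^bsub>?H\<^esub> ?h y"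
      using \<open>M > 0\<close> by (simp add: int_lattice_group_def mult_integer_mod_group mod_add_eq)
  qed
  have onto: "?h ` carrier ?G = carrier ?H"
  proof
    show "?h ` carrier ?G \<subseteq> carrier ?H"
      using hom by (auto simp: hom_def)
    show "carrier ?H \<subseteq> ?h ` carrier ?G"
    proof
      fix k assume "k \<in> carrier ?H"
      then have "k = ?h (of_int k *\<^sub>R u)" by (simp add: carrier_H vu)
      then show "k \<in> ?h ` carrier ?G"
        using u_lattice[of k] unfolding int_lattice_group_def by (intro image_eqI) simp_all
    qed
  qed
  have "kernel ?G ?H ?h = coincidence_lattice (reflection_matrix v)"
    using image_lattice_iff
    by (auto simp: kernel_def int_lattice_group_def mod_eq_0_iff_dvd
        coincidence_lattice_involution[OF reflection_matrix_involution[OF assms(2)]])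
  moreover have "group ?G"
    using comm_group_int_lattice_group by (rule comm_group.axioms(2))
  ultimately have "coincidence_index (reflection_matrix v) = card (carrier ?H)"
    using card_rcosets_kernel[OF _ _ hom onto] by (simp add: coincidence_index_def)
  then have "real (coincidence_index (reflection_matrix v)) = of_int M"
    using \<open>M > 0\<close> by (simp add: carrier_H)
  also have "\<dots> = (if odd N then v \<bullet> v else (v \<bullet> v) / 2)"
    by (auto simp: M_def vv elim!: evenE)
  finally show ?thesis using vv by blast
qed

end
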